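(* Let $m \ge 1$, let $\mathbb{H}_m$ denote $\mathbb{R}^m$ or $\mathbb{C}^m$, and let $\Phi=\{\phi_i\}_{i=1}^n$ be a finite family of vectors in $\mathbb{H}_m$. If $\Phi$ does phase retrieval in $\mathbb{H}_m$, then $\Phi$ has the complement property. Hence, in the real case $\mathbb{H}_m=\mathbb{R}^m$, the family $\Phi$ does phase retrieval if and only if it does phaseless reconstruction.
   Context: $\mathbb{H}_m$ is a real or complex $m$-dimensional Hilbert space, identified with $\mathbb{R}^m$ or $\mathbb{C}^m$ with the standard inner product; vectors are written in coordinates, $x=(a_1,\dots,a_m)$. Same phases: $x=(a_1,\dots,a_m)$ and $y=(b_1,\dots,b_m)$ have the same phases if $a_i$ and $b_i$ have the same phase for every $i=1,\dots,m$. Zero has no phase, so this means that for every $i$ either $a_i=b_i=0$, or $a_i\neq 0\neq b_i$ and $a_i/|a_i|=b_i/|b_i|$. Phase retrieval: $\{\phi_i\}_{i=1}^n$ does phase retrieval if for all $x,y\in\mathbb{H}_m$ with $|\langle x,\phi_i\rangle|=|\langle y,\phi_i\rangle|$ for all $i=1,\dots,n$, there is a scalar $\theta$ with $|\theta|=1$ such that $x$ and $\theta y$ have the same phases. Phaseless reconstruction: $\{\phi_i\}_{i=1}^n$ does phaseless reconstruction if for all $x,y\in\mathbb{H}_m$ with $|\langle x,\phi_i\rangle|=|\langle y,\phi_i\rangle|$ for all $i=1,\dots,n$, there is a scalar $\theta$ with $|\theta|=1$ such that $x=\theta y$. The scalar $\theta$ lies in the field of $\mathbb{H}_m$ (so $\theta=\pm1$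 in the real case). Complement property: $\{\phi_i\}_{i=1}^n$ has the complement property if for every $I\subset\{1,\dots,n\}$, either $\{\phi_i\}_{i\in I}$ spans $\mathbb{H}_m$ or $\{\phi_i\}_{i\in I^c}$ spans $\mathbb{H}_m$. *)

theory Defs
  imports "HOL-Analysis.Analysis"
begin

text \<open>
  The Hilbert space is \<open>real ^ 'm\<close> or \<open>complex ^ 'm\<close>, and its dimension is \<open>CARD('m)\<close>, which is
  automatically at least 1. The notions below are stated for a scalar field \<open>'a\<close> and used with
  \<open>'a = real\<close> and \<open>'a = complex\<close>. On \<open>complex ^ 'm\<close> the library operation \<open>inner\<close> is only the
  real-valued inner product of the underlying real space, so the Hermitian one is defined here
  and the inner product is a parameter \<open>ip\<close> of the two retrieval notions. A family of \<open>n\<close> vectors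
  is a function on \<open>nat\<close> of which only the values on \<open>{1..n}\<close> matter.
\<close>

definition cinner :: "complex ^ 'm \<Rightarrow> complex ^ 'm \<Rightarrow> complex" where
  "cinner x y = (\<Sum>i\<in>UNIV. x $ i * cnj (y $ i))"

text \<open>For a nonzero scalar, \<open>sgn a\<close> is \<open>a\<close> divided by its absolute value.\<close>

definition same_phases :: "'a::real_normed_field ^ 'm \<Rightarrow> 'a ^ 'm \<Rightarrow> bool" where
  "same_phases x y \<longleftrightarrow>
     (\<forall>i. (x $ i = 0 \<and> y $ i = 0) \<or>
          (x $ i \<noteq> 0 \<and> y $ i \<noteq> 0 \<and> sgn (x $ i) = sgn (y $ i)))"

definition phase_retrieval ::
    "('a::real_normed_field ^ 'm \<Rightarrow> 'a ^ 'm \<Rightarrow> 'a) \<Rightarrow> nat \<Rightarrow> (nat \<Rightarrow> 'a ^ 'm) \<Rightarrow> bool" where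
  "phase_retrieval ip n \<phi> \<longleftrightarrow>
     (\<forall>x y. (\<forall>i\<in>{1..n}. norm (ip x (\<phi> i)) = norm (ip y (\<phi> i))) \<longrightarrow>
            (\<exists>\<theta>. norm \<theta> = 1 \<and> same_phases x (\<theta> *s y)))"

definition phaseless_reconstruction ::
    "('a::real_normed_field ^ 'm \<Rightarrow> 'a ^ 'm \<Rightarrow> 'a) \<Rightarrow> nat \<Rightarrow> (nat \<Rightarrow> 'a ^ 'm) \<Rightarrow> bool" where
  "phaseless_reconstruction ip n \<phi> \<longleftrightarrow>
     (\<forall>x y. (\<forall>i\<in>{1..n}. norm (ip x (\<phi> i)) = norm (ip y (\<phi> i))) \<longrightarrow>
            (\<exists>\<theta>. norm \<theta> = 1 \<and> x = \<theta> *s y))"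

text \<open>\<open>vec.span\<close> is the span over the scalar field \<open>'a\<close>; the plain \<open>span\<close> would be the real span.\<close>

definition complement_property :: "nat \<Rightarrow> (nat \<Rightarrow> 'a::field ^ 'm) \<Rightarrow> bool" where
  "complement_property n \<phi> \<longleftrightarrow>
     (\<forall>I\<subseteq>{1..n}. vec.span (\<phi> ` I) = UNIV \<or> vec.span (\<phi> ` ({1..n} - I)) = UNIV)"

end

theory Submission
  imports Defs
begin

text \<open>If neither \<open>I\<close> nor its complement spans, take nonzero \<open>x\<close> and \<open>y\<close> orthogonal to the two
  halves of the family. For every scalar \<open>c\<close> the vectors \<open>x + c y\<close> and \<open>x - c y\<close> have the same
  measurements, hence the same zero coordinates, and choosing \<open>c\<close> to cancel one coordinate shows
  that \<open>x\<close> and \<open>y\<close> have disjoint supports. Comparing \<open>x + y\<close> with \<open>\<theta> (x - y)\<close> on the support of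
  \<open>x\<close> gives \<open>\<theta> = 1\<close>, and on the support of \<open>y\<close> it gives \<open>\<theta> = -1\<close>. In the real case, the complement
  property applied to the indices where \<open>x - y\<close> is orthogonal to the family yields
  \<open>x = y\<close> or \<open>x = -y\<close>.\<close>

text \<open>A linear map that kills \<open>S\<close> but fixes some \<open>u\<close> outside its
  span has a matrix row that does not kill \<open>u\<close>; that row is the annihilator. The
  pairing is bilinear, without conjugation, so the argument covers every field.\<close>

lemma exists_nonzero_annihilator:
  fixes S :: "('a::field ^ 'm) set"
  assumes "vec.span S \<noteq> UNIV"
  obtains a where "a \<noteq> 0" "\<And>v. v \<in> S \<Longrightarrow> (\<Sum>i\<in>UNIV. a $ i * v $ i) = 0"
proof -
  obtain u where u: "u \<notin> vec.span S" using assms by blast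
  obtain B where B: "B \<subseteq> S" "vec.independent B" "S \<subseteq> vec.span B"
    using vec.maximal_independent_subset[of S] by blast
  have uB: "u \<notin> vec.span B" using u vec.span_mono[OF B(1)] by blast
  have "vec.independent (insert u B)"
    using vec.independent_insertI[OF uB B(2)] .
  from vec.linear_independent_extend[OF this, of "\<lambda>v. if v = u then u else 0"]
  obtain f :: "'a ^ 'm \<Rightarrow> 'a ^ 'm"
    where f: "Vector_Spaces.linear (*s) (*s) f" "\<forall>v\<in>insert u B. f v = (if v = u then u else 0)"
    by blast
  have fB: "f v = 0" if "v \<in> S" for v
  proof -
    have "v \<in> vec.span B" using that B(3) by blast
    moreover have "f b = 0" if "b \<in> B" for b
      using f(2) that uB vec.span_base[OF that] by auto
    ultimately show ?thesis using vec.linear_eq_0_on_span[OF f(1), of B v] by simp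
  qed
  have "u \<noteq> 0" using u vec.span_zero by blast
  then obtain k where k: "u $ k \<noteq> 0" by (auto simp: vec_eq_iff)
  have row: "f v $ k = (\<Sum>i\<in>UNIV. (matrix f $ k) $ i * v $ i)" for v
    using matrix_works[OF f(1), of v] by (simp add: matrix_vector_mult_def vec_eq_iff)
  have "matrix f $ k \<noteq> 0"
    using row[of u] k f(2) by auto
  moreover have "(\<Sum>i\<in>UNIV. (matrix f $ k) $ i * v $ i) = 0" if "v \<in> S" for v
    using row[of v] fB[OF that] by simp
  ultimately show thesis by (rule that)
qed

text \<open>Keeping \<open>ip\<close> abstract treats both fields at once: the argument rests on
  linearity in the first slot and on nonzero annihilators of non-spanning sets.\<close>

lemma phase_retrieval_imp_complement_property:
  fixes ip :: "'a::real_normed_field ^ 'm \<Rightarrow> 'a ^ 'm \<Rightarrow> 'a"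
  assumes add: "\<And>x y v. ip (x + y) v = ip x v + ip y v"
    and scale: "\<And>c x v. ip (c *s x) v = c * ip x v"
    and ann: "\<And>S. vec.span S \<noteq> UNIV \<Longrightarrow> \<exists>x. x \<noteq> 0 \<and> (\<forall>v\<in>S. ip x v = 0)"
    and pr: "phase_retrieval ip n \<phi>"
  shows "complement_property n \<phi>"
  unfolding complement_property_def
proof (intro allI impI, rule ccontr)
  fix I assume "I \<subseteq> {1..n}"
    and "\<not> (vec.span (\<phi> ` I) = UNIV \<or> vec.span (\<phi> ` ({1..n} - I)) = UNIV)"
  then have ns: "vec.span (\<phi> ` I) \<noteq> UNIV" "vec.span (\<phi> ` ({1..n} - I)) \<noteq> UNIV"
    by simp_all
  obtain x where x: "x \<noteq> 0" "\<And>i. i \<in> I \<Longrightarrow> ip x (\<phi> i) = 0"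
    using ann[OF ns(1)] by auto
  obtain y where y: "y \<noteq> 0" "\<And>i. i \<in> {1..n} - I \<Longrightarrow> ip y (\<phi> i) = 0"
    using ann[OF ns(2)] by auto
  have key: "\<exists>\<theta>. norm \<theta> = 1 \<and> same_phases (x + c *s y) (\<theta> *s (x + (- c) *s y))" for c
  proof -
    \<comment> \<open>On \<open>I\<close> only the \<open>y\<close> term survives, off
      \<open>I\<close> only the \<open>x\<close> term, so the sign of \<open>c\<close> does not
      affect the norm.\<close>
    have "norm (ip (x + c *s y) (\<phi> i)) = norm (ip (x + (- c) *s y) (\<phi> i))" if "i \<in> {1..n}" for i
      using x(2)[of i] y(2)[of i] that unfolding add scale by (cases "i \<in> I") auto
    then show ?thesis using pr unfolding phase_retrieval_def by blast
  qed
  have disj: "x $ i = 0 \<or> y $ i = 0" for i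
  proof (rule ccontr)
    assume "\<not> ?thesis"
    then have nz: "x $ i \<noteq> 0" "y $ i \<noteq> 0" by auto
    obtain \<theta> where th: "norm \<theta> = 1"
      "same_phases (x + (- (x $ i / y $ i)) *s y) (\<theta> *s (x + (- (- (x $ i / y $ i))) *s y))"
      using key by blast
    \<comment> \<open>The left vector vanishes at \<open>i\<close>, so its partner must too, yet the
      partner's coordinate there is \<open>\<theta> * (2 * x $ i)\<close>.\<close>
    have "(\<theta> *s (x + (- (- (x $ i / y $ i))) *s y)) $ i = 0"
      using th(2) nz unfolding same_phases_def by (auto dest!: spec[of _ i])
    then have "\<theta> * (2 * x $ i) = 0" using nz by simp
    then show False using th(1) nz by auto
  qed
  obtain i j where ij: "x $ i \<noteq> 0" "y $ j \<noteq> 0" using x(1) y(1) by (auto simp: vec_eq_iff)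
  then have ji: "y $ i = 0" "x $ j = 0" using disj by blast+
  obtain \<theta> where th: "norm \<theta> = 1" "same_phases (x + 1 *s y) (\<theta> *s (x + (- 1) *s y))"
    using key by blast
  \<comment> \<open>A unimodular scalar is its own phase, so \<open>\<theta>\<close> passes
    unchanged through the multiplicative \<open>sgn\<close>.\<close>
  have sgn_th: "sgn \<theta> = \<theta>" using th(1) by (simp add: sgn_div_norm)
  have "sgn (x $ i) = \<theta> * sgn (x $ i)"
    using th(2) ij ji sgn_th unfolding same_phases_def
    by (auto simp: Real_Vector_Spaces.sgn_mult dest!: spec[of _ i])
  then have "\<theta> = 1" using ij by (simp add: sgn_zero_iff)
  moreover have "sgn (y $ j) = \<theta> * - sgn (y $ j)"
    using th(2) ij ji sgn_th unfolding same_phases_def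
    by (auto simp: Real_Vector_Spaces.sgn_mult Real_Vector_Spaces.sgn_minus dest!: spec[of _ j])
  ultimately have "2 * sgn (y $ j) = 0" by (simp add: eq_neg_iff_add_eq_0)
  then show False using ij by (simp add: sgn_zero_iff)
qed

lemma phase_retrieval_imp_complement_property_real:
  fixes \<phi> :: "nat \<Rightarrow> real ^ 'm"
  assumes "phase_retrieval (\<bullet>) n \<phi>"
  shows "complement_property n \<phi>"
proof (rule phase_retrieval_imp_complement_property[OF _ _ _ assms])
  show "\<exists>x. x \<noteq> 0 \<and> (\<forall>v\<in>S. x \<bullet> v = 0)" if S: "vec.span S \<noteq> UNIV" for S :: "(real ^ 'm) set"
  proof -
    obtain a where "a \<noteq> 0" "\<And>v. v \<in> S \<Longrightarrow> (\<Sum>i\<in>UNIV. a $ i * v $ i) = 0"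
      using exists_nonzero_annihilator[OF S] by blast
    then show ?thesis by (auto simp: inner_vec_def)
  qed
qed (simp_all add: inner_add_left scalar_mult_eq_scaleR)

lemma phase_retrieval_imp_complement_property_complex:
  fixes \<psi> :: "nat \<Rightarrow> complex ^ 'm"
  assumes "phase_retrieval cinner n \<psi>"
  shows "complement_property n \<psi>"
proof (rule phase_retrieval_imp_complement_property[OF _ _ _ assms])
  show "\<exists>x. x \<noteq> 0 \<and> (\<forall>v\<in>S. cinner x v = 0)" if S: "vec.span S \<noteq> UNIV" for S :: "(complex ^ 'm) set"
  proof -
    obtain a where a: "a \<noteq> 0" "\<And>v. v \<in> S \<Longrightarrow> (\<Sum>i\<in>UNIV. a $ i * v $ i) = 0"
      using exists_nonzero_annihilator[OF S] by blast
    \<comment> \<open>\<open>cinner\<close> conjugates its second argument; conjugating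
      \<open>a\<close> as well makes the Hermitian product the conjugate of the bilinear
      one.\<close>
    have "cinner (\<chi> i. cnj (a $ i)) v = cnj (\<Sum>i\<in>UNIV. a $ i * v $ i)" for v
      by (simp add: cinner_def)
    moreover have "(\<chi> i. cnj (a $ i)) \<noteq> 0" using a(1) by (simp add: vec_eq_iff)
    ultimately show ?thesis using a(2) by (metis complex_cnj_zero)
  qed
qed (simp_all add: cinner_def sum_distrib_left mult.assoc distrib_right sum.distrib)

text \<open>The vectors orthogonal to \<open>z\<close> form a subspace containing \<open>S\<close>,
  hence everything, including \<open>z\<close> itself.\<close>

lemma vec_span_orthogonal_eq_0:
  fixes z :: "real ^ 'm"
  assumes "vec.span S = UNIV" "\<And>v. v \<in> S \<Longrightarrow> z \<bullet> v = 0"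
  shows "z = 0"
proof -
  have "vec.subspace {v. z \<bullet> v = 0}"
    unfolding vec.subspace_def by (simp add: inner_add_right scalar_mult_eq_scaleR)
  then have "vec.span S \<subseteq> {v. z \<bullet> v = 0}"
    using assms(2) by (intro vec.span_minimal) auto
  then have "z \<bullet> z = 0" using assms(1) by blast
  then show ?thesis by simp
qed

lemma complement_property_imp_phaseless_reconstruction:
  fixes \<phi> :: "nat \<Rightarrow> real ^ 'm"
  assumes "complement_property n \<phi>"
  shows "phaseless_reconstruction (\<bullet>) n \<phi>"
  unfolding phaseless_reconstruction_def
proof (intro allI impI)
  fix x y assume eq: "\<forall>i\<in>{1..n}. norm (x \<bullet> \<phi> i) = norm (y \<bullet> \<phi> i)"
  define I where "I = {i\<in>{1..n}. (x - y) \<bullet> \<phi> i = 0}"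
  \<comment> \<open>Real numbers of equal absolute value are equal or opposite, and outside
    \<open>I\<close> they are not equal.\<close>
  have I': "(x + y) \<bullet> \<phi> i = 0" if "i \<in> {1..n} - I" for i
    using eq that by (auto simp: I_def inner_diff_left inner_add_left abs_eq_iff)
  have "I \<subseteq> {1..n}" by (auto simp: I_def)
  then consider "vec.span (\<phi> ` I) = UNIV" | "vec.span (\<phi> ` ({1..n} - I)) = UNIV"
    using assms unfolding complement_property_def by blast
  then show "\<exists>\<theta>. norm \<theta> = 1 \<and> x = \<theta> *s y"
  proof cases
    case 1
    then have "x - y = 0" by (rule vec_span_orthogonal_eq_0) (auto simp: I_def)
    then show ?thesis by (intro exI[of _ 1]) simp
  next
    case 2
    then have "x + y = 0" by (rule vec_span_orthogonal_eq_0) (use I' in blast)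
    then show ?thesis
      by (intro exI[of _ "-1"]) (simp add: eq_neg_iff_add_eq_0 scalar_mult_eq_scaleR)
  qed
qed

lemma phaseless_reconstruction_imp_phase_retrieval:
  "phaseless_reconstruction ip n \<phi> \<Longrightarrow> phase_retrieval ip n \<phi>"
  unfolding phase_retrieval_def
proof (intro allI impI)
  fix x y
  assume pr: "phaseless_reconstruction ip n \<phi>"
    and eq: "\<forall>i\<in>{1..n}. norm (ip x (\<phi> i)) = norm (ip y (\<phi> i))"
  from pr[unfolded phaseless_reconstruction_def, THEN spec, THEN spec, THEN mp, OF eq]
  obtain \<theta> where "norm \<theta> = 1" "x = \<theta> *s y" by (elim exE conjE)
  then show "\<exists>\<theta>. norm \<theta> = 1 \<and> same_phases x (\<theta> *s y)"
    by (intro exI[of _ \<theta>]) (auto simp: same_phases_def)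
qed

theorem corollary2p6:
  fixes n :: nat
    and \<phi> :: "nat \<Rightarrow> real ^ 'm"
    and \<psi> :: "nat \<Rightarrow> complex ^ 'm"
  shows "(phase_retrieval (\<bullet>) n \<phi> \<longrightarrow> complement_property n \<phi>) \<and>
         (phase_retrieval cinner n \<psi> \<longrightarrow> complement_property n \<psi>) \<and>
         (phase_retrieval (\<bullet>) n \<phi> \<longleftrightarrow> phaseless_reconstruction (\<bullet>) n \<phi>)"
proof (intro conjI impI iffI)
  \<comment> \<open>This block settles both the first conjunct and the forward half of the
    equivalence, which share their assumption.\<close>
  assume "phase_retrieval (\<bullet>) n \<phi>"
  then show "complement_property n \<phi>"
    by (rule phase_retrieval_imp_complement_property_real)
  then show "phaseless_reconstruction (\<bullet>) n \<phi>"
    by (rule complement_property_imp_phaseless_reconstruction)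
next
  assume "phase_retrieval cinner n \<psi>"
  then show "complement_property n \<psi>"
    by (rule phase_retrieval_imp_complement_property_complex)
next
  assume "phaseless_reconstruction (\<bullet>) n \<phi>"
  then show "phase_retrieval (\<bullet>) n \<phi>"
    by (rule phaseless_reconstruction_imp_phase_retrieval)
qed

end
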